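(* Let $G$ be a weighted digraph on $V=\{1,\dots,n\}$ with random walk Laplacian $\mathcal{L}=I-S$ and with exactly $k$ reaches $R_1,\dots,R_k$. Let $\{\gamma_m\}_{m=1}^k$ (columns) and $\{\bar\gamma_m\}_{m=1}^k$ (rows) be the bases of the right and left kernels of $\mathcal{L}$ described in the context. Then the solution $x^{(t)}$ of the consensus problem $\dot x=-\mathcal{L}x$ with initial condition $x^{(0)}\in\mathbb{R}^n$ at $t=0$ satisfies $$\lim_{t\to\infty}x^{(t)}=\sum_{m=1}^k\left(\bar\gamma_m x^{(0)}\right)\gamma_m,$$ where $\bar\gamma_m x^{(0)}$ is a scalar.
   Context: $G$ is a weakly connected (i.e. its underlying undirected graph is connected) weighted directed graph on $V=\{1,\dots,n\}$ with directed edge set $E\subseteq V\times V$; $ji\in E$ denotes an edge $j\to i$, carrying a weight $w_{ji}>0$. The adjacency matrix $Q$ has $Q_{ij}=w_{ji}$ if $ji\in E$ and $0$ otherwise; if row $i$ of $Q$ is zero, $Q_{ii}$ is replaced by $1$ (the result is still called $Q$). $D$ is the diagonal matrix with $D_{ii}=\sum_j Q_{ij}$, $S=D^{-1}Q$ (row stochastic), and $\mathcal{L}=I-S$ is the random walk Laplacian. Write $j\rightsquigarrow i$ if there is a directed path from $j$ to $i$. The reachable set of $j$ is $R(j)=\{j\}\cup\{i: j\rightsquigarrow i\}$. A reach is a set of the form $R(j)$ that is maximal with respect to inclusion among all reachable sets. The distinct reaches are $R_1,\dots,R_k$; the exclusive part of $R_i$ is $H_i=R_i\setminus\bigcup_{j\ne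 i}R_j$, the common part is $C_i=R_i\setminus H_i$, and the cabal $B_i$ of $R_i$ is the set of its roots, i.e. of vertices $r\in R_i$ with $R(r)=R_i$. $\gamma_1,\dots,\gamma_k$ is the basis of the right kernel $\{x:\mathcal{L}x=0\}$ (column vectors; the kernel is known to have dimension $k$ and to possess such a basis) satisfying: $\gamma_i(v)=1$ for $v\in H_i$; $\gamma_i(v)\in(0,1)$ for $v\in C_i$; $\gamma_i(v)=0$ for $v\notin R_i$; $\sum_i\gamma_i$ is the all-ones vector. $\bar\gamma_1,\dots,\bar\gamma_k$ is the basis of the left kernel $\{p: p\mathcal{L}=0\}$ (row vectors) satisfying: $\bar\gamma_i(v)\ge0$ for all $v$; the support of $\bar\gamma_i$ is $B_i$; $\sum_v\bar\gamma_i(v)=1$. *)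

theory Defs
  imports "HOL-Analysis.Analysis"
begin

text \<open>
  The vertex set \<open>{1,\<dots>,n}\<close> is the finite type \<open>'n\<close>. A pair \<open>(j, i) \<in> E\<close> is the
  edge \<open>j \<rightarrow> i\<close>, with weight \<open>w j i\<close>; loops are allowed, and \<open>w\<close> is irrelevant off \<open>E\<close>.
\<close>

definition weakly_connected :: "('n \<times> 'n) set \<Rightarrow> bool" where
  "weakly_connected E \<longleftrightarrow> (\<forall>u v. (u, v) \<in> (E \<union> E\<inverse>)\<^sup>*)"

definition weighted_digraph :: "('n \<times> 'n) set \<Rightarrow> ('n \<Rightarrow> 'n \<Rightarrow> real) \<Rightarrow> bool" where
  "weighted_digraph E w \<longleftrightarrow> weakly_connected E \<and> (\<forall>(j, i)\<in>E. 0 < w j i)"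

definition raw_adjacency :: "('n \<times> 'n) set \<Rightarrow> ('n \<Rightarrow> 'n \<Rightarrow> real) \<Rightarrow> real^'n^'n" where
  "raw_adjacency E w = (\<chi> i j. if (j, i) \<in> E then w j i else 0)"

definition adjacency :: "('n \<times> 'n) set \<Rightarrow> ('n \<Rightarrow> 'n \<Rightarrow> real) \<Rightarrow> real^'n^'n" where
  "adjacency E w =
     (\<chi> i j. if i = j \<and> raw_adjacency E w $ i = 0 then 1 else raw_adjacency E w $ i $ j)"

definition degree_matrix :: "('n::finite \<times> 'n) set \<Rightarrow> ('n \<Rightarrow> 'n \<Rightarrow> real) \<Rightarrow> real^'n^'n" where
  "degree_matrix E w = (\<chi> i j. if i = j then \<Sum>l\<in>UNIV. adjacency E w $ i $ l else 0)"

definition transition_matrix :: "('n::finite \<times> 'n) set \<Rightarrow> ('n \<Rightarrow> 'n \<Rightarrow> real) \<Rightarrow> real^'n^'n" where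
  "transition_matrix E w = matrix_inv (degree_matrix E w) ** adjacency E w"

definition rw_laplacian :: "('n::finite \<times> 'n) set \<Rightarrow> ('n \<Rightarrow> 'n \<Rightarrow> real) \<Rightarrow> real^'n^'n" where
  "rw_laplacian E w = mat 1 - transition_matrix E w"

definition reachable_set :: "('n \<times> 'n) set \<Rightarrow> 'n \<Rightarrow> 'n set" where
  "reachable_set E j = {j} \<union> {i. (j, i) \<in> E\<^sup>+}"

definition reaches :: "('n \<times> 'n) set \<Rightarrow> 'n set set" where
  "reaches E = {X \<in> range (reachable_set E). \<forall>Y \<in> range (reachable_set E). X \<subseteq> Y \<longrightarrow> Y = X}"

definition exclusive_part :: "('n \<times> 'n) set \<Rightarrow> 'n set \<Rightarrow> 'n set" where
  "exclusive_part E X = X - \<Union>(reaches E - {X})"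

definition common_part :: "('n \<times> 'n) set \<Rightarrow> 'n set \<Rightarrow> 'n set" where
  "common_part E X = X - exclusive_part E X"

definition cabal :: "('n \<times> 'n) set \<Rightarrow> 'n set \<Rightarrow> 'n set" where
  "cabal E X = {r \<in> X. reachable_set E r = X}"

definition is_basis_of :: "nat \<Rightarrow> (nat \<Rightarrow> 'a::real_vector) \<Rightarrow> 'a set \<Rightarrow> bool" where
  "is_basis_of k b U \<longleftrightarrow>
     inj_on b {1..k} \<and> independent (b ` {1..k}) \<and> span (b ` {1..k}) = U"

text \<open>
  In the next two definitions \<open>R 1, \<dots>, R k\<close> is meant to enumerate the reaches of the digraph.
  Row vectors are also elements of \<^typ>\<open>real^'n\<close>, acting on matrices from the left through
  \<open>v*\<close>; the product of a row and a column is their inner product.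
\<close>

definition reach_basis_right ::
  "('n::finite \<times> 'n) set \<Rightarrow> ('n \<Rightarrow> 'n \<Rightarrow> real) \<Rightarrow> nat \<Rightarrow> (nat \<Rightarrow> 'n set) \<Rightarrow> (nat \<Rightarrow> real^'n) \<Rightarrow> bool"
  where
  "reach_basis_right E w k R \<gamma> \<longleftrightarrow>
     is_basis_of k \<gamma> {x. rw_laplacian E w *v x = 0} \<and>
     (\<forall>m\<in>{1..k}.
        (\<forall>v\<in>exclusive_part E (R m). \<gamma> m $ v = 1) \<and>
        (\<forall>v\<in>common_part E (R m). \<gamma> m $ v \<in> {0<..<1}) \<and>
        (\<forall>v. v \<notin> R m \<longrightarrow> \<gamma> m $ v = 0)) \<and>
     (\<Sum>m=1..k. \<gamma> m) = (\<chi> v. 1)"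

definition reach_basis_left ::
  "('n::finite \<times> 'n) set \<Rightarrow> ('n \<Rightarrow> 'n \<Rightarrow> real) \<Rightarrow> nat \<Rightarrow> (nat \<Rightarrow> 'n set) \<Rightarrow> (nat \<Rightarrow> real^'n) \<Rightarrow> bool"
  where
  "reach_basis_left E w k R \<gamma>' \<longleftrightarrow>
     is_basis_of k \<gamma>' {p. p v* rw_laplacian E w = 0} \<and>
     (\<forall>m\<in>{1..k}.
        (\<forall>v. 0 \<le> \<gamma>' m $ v) \<and>
        {v. \<gamma>' m $ v \<noteq> 0} = cabal E (R m) \<and>
        (\<Sum>v\<in>UNIV. \<gamma>' m $ v) = 1)"

definition consensus_solution :: "real^'n^'n \<Rightarrow> real^'n \<Rightarrow> (real \<Rightarrow> real^'n) \<Rightarrow> bool" where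
  "consensus_solution L x0 x \<longleftrightarrow>
     x 0 = x0 \<and> (\<forall>t\<ge>0. (x has_vector_derivative - (L *v x t)) (at t within {0..}))"

end

theory Submission
  imports Defs
begin

text \<open>
  Let \<open>p\<close> be the claimed limit and \<open>y = x - p\<close>. Since \<open>p\<close> lies in the right kernel of the
  Laplacian \<open>L = I - S\<close>, the function \<open>y\<close> solves the same equation as \<open>x\<close>, and what has to be
  shown is \<open>y \<longlongrightarrow> 0\<close>.

  The two bases are biorthogonal (\<open>reach_bases_biorthogonal\<close>): a root of a reach belongs to no
  other reach, so on the cabal that supports a left basis vector the right basis vectors only
  take the values 0 and 1. Hence every left basis vector annihilates \<open>y 0\<close>. As these vectors span
  the left kernel, \<open>y 0\<close> is orthogonal to the left kernel, which means \<open>y 0 = L z\<^sub>0\<close> for some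
  \<open>z\<^sub>0\<close> (\<open>orthogonal_to_left_kernel_imp_in_range\<close>).

  It remains to see that a solution starting in the range of \<open>L\<close> decays
  (\<open>consensus_flow_range_tendsto_0\<close>), which rests on \<open>S\<close> being row stochastic. Such a solution is \<open>y = L z = - z'\<close> for a solution \<open>z\<close> of the same equation
  (\<open>consensus_flow_lift\<close>), and the maximum norm of any solution is nonincreasing
  (\<open>consensus_flow_infnorm_antimono\<close>), so \<open>z\<close> is bounded. Suppose that the maximum norm of \<open>y\<close>
  tended to some \<open>l > 0\<close>. A component of \<open>y\<close> that is nearly extremal at a late time must have been
  nearly extremal, with the same sign, during a long time before
  (\<open>consensus_gap_backward_estimate\<close>). The same component of \<open>z\<close>, whose derivative is the negative
  of it, then moves farther than its bound allows.
\<close>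

section \<open>The transition matrix is row stochastic\<close>

definition row_stochastic :: "real^'n^'n \<Rightarrow> bool" where
  "row_stochastic S \<longleftrightarrow> (\<forall>i j. 0 \<le> S $ i $ j) \<and> (\<forall>i. (\<Sum>j\<in>UNIV. S $ i $ j) = 1)"

lemma adjacency_nonneg:
  assumes "weighted_digraph E w"
  shows "0 \<le> adjacency E w $ i $ j"
  using assms unfolding weighted_digraph_def adjacency_def raw_adjacency_def
  by (auto simp: less_imp_le)

text \<open>
  A zero row of the raw adjacency matrix receives the diagonal entry 1, and a nonzero row has a
  positive entry, so that the degree matrix is invertible.
\<close>

lemma adjacency_row_sum_pos:
  fixes E :: "('n::finite \<times> 'n) set"
  assumes "weighted_digraph E w"
  shows "0 < (\<Sum>j\<in>UNIV. adjacency E w $ i $ j)"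
proof -
  obtain j where "adjacency E w $ i $ j \<noteq> 0"
  proof (cases "raw_adjacency E w $ i = 0")
    case True
    then have "adjacency E w $ i $ i \<noteq> 0"
      by (simp add: adjacency_def)
    then show ?thesis by (rule that)
  next
    case False
    then obtain j where "raw_adjacency E w $ i $ j \<noteq> 0"
      by (auto simp: vec_eq_iff)
    with False have "adjacency E w $ i $ j \<noteq> 0"
      by (simp add: adjacency_def)
    then show ?thesis by (rule that)
  qed
  with adjacency_nonneg[OF assms, of i j] have "0 < adjacency E w $ i $ j"
    by simp
  then show ?thesis
    by (intro sum_pos2[where i = j]) (auto intro: adjacency_nonneg[OF assms])
qed

lemma transition_matrix_entry:
  fixes E :: "('n::finite \<times> 'n) set"
  assumes "weighted_digraph E w"
  shows "transition_matrix E w $ i $ j =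
           adjacency E w $ i $ j / (\<Sum>l\<in>UNIV. adjacency E w $ i $ l)"
proof -
  let ?D = "degree_matrix E w"
  let ?d = "\<lambda>i. \<Sum>l\<in>UNIV. adjacency E w $ i $ l"
  have pos: "?d i > 0" for i
    by (rule adjacency_row_sum_pos[OF assms])
  then have nz: "?d i \<noteq> 0" for i
    by (metis less_irrefl)
  have "det ?D = (\<Prod>i\<in>UNIV. ?D $ i $ i)"
    by (rule det_diagonal) (simp add: degree_matrix_def)
  also have "\<dots> \<noteq> 0"
    using nz by (simp add: degree_matrix_def)
  finally have "invertible ?D"
    by (simp add: invertible_det_nz)
  then have "?D ** matrix_inv ?D = mat 1"
    unfolding invertible_def matrix_inv_def by (rule someI2_ex) simp
  then have "?D ** transition_matrix E w = adjacency E w"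
    by (simp add: transition_matrix_def matrix_mul_assoc)
  then have "(?D ** transition_matrix E w) $ i $ j = adjacency E w $ i $ j"
    by simp
  moreover have "(?D ** transition_matrix E w) $ i $ j = ?d i * transition_matrix E w $ i $ j"
    by (simp add: matrix_matrix_mult_def degree_matrix_def if_distrib[where f = "\<lambda>x. x * _"] cong: if_cong)
  ultimately show ?thesis
    using pos[of i] by (simp add: field_simps)
qed

lemma row_stochastic_transition_matrix:
  fixes E :: "('n::finite \<times> 'n) set"
  assumes "weighted_digraph E w"
  shows "row_stochastic (transition_matrix E w)"
  unfolding row_stochastic_def
  using adjacency_row_sum_pos[OF assms] adjacency_nonneg[OF assms]
  by (auto simp: transition_matrix_entry[OF assms] sum_divide_distrib[symmetric] sum_nonneg)
    (metis less_irrefl)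

section \<open>A maximum principle\<close>

lemma infnorm_attained_cart:
  fixes x :: "real^'n"
  obtains i where "\<bar>x $ i\<bar> = infnorm x"
proof -
  have set: "{\<bar>x $ i\<bar> | i. i \<in> UNIV} = range (\<lambda>i. \<bar>x $ i\<bar>)"
    by auto
  have "infnorm x = Max (range (\<lambda>i. \<bar>x $ i\<bar>))"
    unfolding infnorm_cart set by (intro cSup_eq_Max) auto
  also have "\<dots> \<in> range (\<lambda>i. \<bar>x $ i\<bar>)"
    by (intro Max_in) auto
  finally show ?thesis
    using that by auto
qed

text \<open>
  Each component of \<open>S v\<close> is a convex combination of the components of \<open>v\<close>.
\<close>

lemma stochastic_component_le_infnorm:
  fixes S :: "real^'n^'n"
  assumes "row_stochastic S"
  shows "\<bar>(S *v v) $ i\<bar> \<le> infnorm v"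
proof -
  have "\<bar>(S *v v) $ i\<bar> \<le> (\<Sum>j\<in>UNIV. \<bar>S $ i $ j * v $ j\<bar>)"
    unfolding matrix_vector_mult_def by (simp add: sum_abs)
  also have "\<dots> \<le> (\<Sum>j\<in>UNIV. S $ i $ j * infnorm v)"
    using assms
    by (intro sum_mono) (auto simp: row_stochastic_def abs_mult component_le_infnorm_cart
        intro!: mult_left_mono)
  also have "\<dots> = infnorm v"
    using assms by (simp add: row_stochastic_def sum_distrib_right[symmetric])
  finally show ?thesis .
qed

text \<open>
  The differential equation alone, without a prescribed initial value: the estimates below
  compare a solution at arbitrary times.
\<close>

definition consensus_flow :: "real^'n^'n \<Rightarrow> (real \<Rightarrow> real^'n) \<Rightarrow> bool" where
  "consensus_flow L y \<longleftrightarrow> (\<forall>t\<ge>0. (y has_vector_derivative - (L *v y t)) (at t within {0..}))"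

lemma consensus_flow_continuous_on:
  assumes "consensus_flow L y" "0 \<le> s"
  shows "continuous_on {s..t} y"
proof -
  have "continuous_on {0..} y"
    using assms(1) unfolding consensus_flow_def
    by (auto simp: continuous_on_eq_continuous_within intro: has_vector_derivative_continuous)
  then show ?thesis
    by (rule continuous_on_subset) (use assms(2) in auto)
qed

lemma consensus_flow_component_deriv:
  assumes "consensus_flow L y" "0 < t"
  shows "((\<lambda>t. y t $ i) has_real_derivative - ((L *v y t) $ i)) (at t)"
proof -
  have "(y has_vector_derivative - (L *v y t)) (at t within {0..})"
    using assms unfolding consensus_flow_def by simp
  then have "(y has_vector_derivative - (L *v y t)) (at t)"
    using assms(2) by (simp only: at_within_interior[of t "{0..}"] interior_real_atLeast greaterThan_iff)
  then have "((\<lambda>t. y t $ i) has_vector_derivative (- (L *v y t)) $ i) (at t)"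
    by (rule bounded_linear.has_vector_derivative[OF bounded_linear_vec_nth])
  then show ?thesis
    by (simp add: has_real_derivative_iff_has_vector_derivative)
qed

text \<open>
  The equation \<open>y' = S y - y\<close> gives
  \<open>(exp t * (K - \<sigma> * y t $ i))' = exp t * (K - \<sigma> * (S *v y t) $ i)\<close>, which is nonnegative as long
  as the maximum norm of \<open>y\<close> is at most \<open>K\<close>. So the gap between a component and the bound \<open>K\<close>
  shrinks at most exponentially: a component that is close to the bound has been close to it for
  some time. The sign \<open>\<sigma>\<close> treats the bounds \<open>K\<close> and \<open>- K\<close> together.
\<close>

lemma consensus_gap_backward_estimate:
  fixes S :: "real^'n^'n"
  assumes "row_stochastic S" "consensus_flow (mat 1 - S) y" "0 \<le> s" "s \<le> t"
    and K: "\<And>r. s \<le> r \<Longrightarrow> r \<le> t \<Longrightarrow> infnorm (y r) \<le> K"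
    and \<sigma>: "\<bar>\<sigma>\<bar> = 1"
  shows "K - \<sigma> * y s $ i \<le> exp (t - s) * (K - \<sigma> * y t $ i)"
proof -
  define g where "g r = exp r * (K - \<sigma> * y r $ i)" for r
  have "g s \<le> g t"
  proof (rule DERIV_nonneg_imp_increasing_open[OF \<open>s \<le> t\<close>])
    fix r assume r: "s < r" "r < t"
    have "((\<lambda>t. y t $ i) has_real_derivative (S *v y r) $ i - y r $ i) (at r)"
      using consensus_flow_component_deriv[OF assms(2), of r i] r \<open>0 \<le> s\<close>
      by (simp add: matrix_vector_mult_diff_rdistrib)
    then have "(g has_real_derivative exp r * (K - \<sigma> * (S *v y r) $ i)) (at r)"
      unfolding g_def by (auto intro!: derivative_eq_intros simp: algebra_simps)
    moreover have "\<sigma> * (S *v y r) $ i \<le> K"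
    proof -
      have "\<sigma> * (S *v y r) $ i \<le> \<bar>(S *v y r) $ i\<bar>"
        using \<sigma> by (metis abs_ge_self abs_mult mult_1)
      also have "\<dots> \<le> K"
        using stochastic_component_le_infnorm[OF assms(1)] K[of r] r by (meson less_imp_le order_trans)
      finally show ?thesis .
    qed
    ultimately show "\<exists>D. (g has_real_derivative D) (at r) \<and> D \<ge> 0"
      by (intro exI conjI) auto
  next
    show "continuous_on {s..t} g"
      unfolding g_def using consensus_flow_continuous_on[OF assms(2,3)]
      by (intro continuous_intros) auto
  qed
  then show ?thesis
    by (simp add: g_def exp_diff field_simps)
qed

text \<open>
  At a time in \<open>{s..t}\<close> where the maximum norm is largest, the gap of an extremal component is 0.
  By the backward estimate the gap was already 0 at the initial time \<open>s\<close>.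
\<close>

lemma consensus_flow_infnorm_antimono:
  fixes S :: "real^'n^'n"
  assumes S: "row_stochastic S" and y: "consensus_flow (mat 1 - S) y" and "0 \<le> s" "s \<le> t"
  shows "infnorm (y t) \<le> infnorm (y s)"
proof -
  have "continuous_on {s..t} (\<lambda>r. infnorm (y r))"
    using consensus_flow_continuous_on[OF y \<open>0 \<le> s\<close>, of t]
    by (rule continuous_on_infnorm)
  then obtain r where r: "r \<in> {s..t}" and max: "\<And>q. q \<in> {s..t} \<Longrightarrow> infnorm (y q) \<le> infnorm (y r)"
    using continuous_attains_sup[of "{s..t}" "\<lambda>r. infnorm (y r)"] \<open>s \<le> t\<close> by auto
  obtain i where i: "\<bar>y r $ i\<bar> = infnorm (y r)"
    by (rule infnorm_attained_cart)
  define \<sigma> :: real where "\<sigma> = (if y r $ i \<ge> 0 then 1 else - 1)"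
  have \<sigma>: "\<bar>\<sigma>\<bar> = 1" "\<sigma> * y r $ i = infnorm (y r)"
    using i by (auto simp: \<sigma>_def)
  have "infnorm (y r) - \<sigma> * y s $ i \<le> exp (r - s) * (infnorm (y r) - \<sigma> * y r $ i)"
    by (rule consensus_gap_backward_estimate[OF S y]) (use assms r max \<sigma> in auto)
  then have "infnorm (y r) \<le> \<sigma> * y s $ i"
    using \<sigma> by simp
  also have "\<dots> \<le> \<bar>y s $ i\<bar>"
    using \<sigma>(1) by (metis abs_ge_self abs_mult mult_1)
  also have "\<dots> \<le> infnorm (y s)"
    by (rule component_le_infnorm_cart)
  finally show ?thesis
    using max[of t] \<open>s \<le> t\<close> by simp
qed

section \<open>Decay of solutions that start in the range of the Laplacian\<close>

text \<open>
  The solution \<open>z\<close> is an antiderivative of \<open>- y\<close>: then \<open>L z\<close> and \<open>y\<close> have the same derivative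
  \<open>- L y\<close> and the same initial value, so \<open>L z = y\<close>, and \<open>z' = - y\<close> becomes \<open>z' = - L z\<close>.
\<close>

lemma consensus_flow_lift:
  fixes L :: "real^'n^'n"
  assumes y: "consensus_flow L y" and "y 0 = L *v z0"
  obtains z where "consensus_flow L z" "\<And>t. 0 \<le> t \<Longrightarrow> L *v z t = y t"
proof -
  define z where "z t = z0 - integral {0..t} y" for t
  have z': "(z has_vector_derivative - y t) (at t within {0..})" if "0 \<le> t" for t
  proof -
    have "((\<lambda>u. integral {0..u} y) has_vector_derivative y t) (at t within {0..t + 1})"
      by (rule integral_has_vector_derivative)
        (use that consensus_flow_continuous_on[OF y] in auto)
    moreover have "at t within {0..t + 1} = at t within {0..}"
      by (rule at_within_nhd[where S = "{..<t + 1}"]) auto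
    ultimately show ?thesis
      unfolding z_def by (auto intro!: derivative_eq_intros)
  qed
  have Lz: "L *v z t = y t" if "0 \<le> t" for t
  proof -
    have "((\<lambda>t. L *v z t - y t) has_vector_derivative 0) (at r within {0..})" if "r \<in> {0..}" for r
    proof -
      have "((\<lambda>t. L *v z t) has_vector_derivative L *v (- y r)) (at r within {0..})"
        using that by (intro bounded_linear.has_vector_derivative[OF matrix_vector_mul_bounded_linear] z') auto
      moreover have "(y has_vector_derivative - (L *v y r)) (at r within {0..})"
        using y that by (simp add: consensus_flow_def)
      ultimately have "((\<lambda>t. L *v z t - y t) has_vector_derivative L *v (- y r) - - (L *v y r))
          (at r within {0..})"
        by (rule has_vector_derivative_diff)
      then show ?thesis
        by (simp add: vec.neg)
    qed
    from has_vector_derivative_zero_constant[OF convex_real_interval(1) this]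
    obtain c where "\<And>r. r \<in> {0..} \<Longrightarrow> L *v z r - y r = c"
      by blast
    from this[of t] this[of 0] show ?thesis
      using that assms(2) by (simp add: z_def)
  qed
  show ?thesis
    by (rule that[of z]) (use z' Lz in \<open>auto simp: consensus_flow_def\<close>)
qed

text \<open>
  If the maximum norm of \<open>y = L z\<close> never fell below \<open>c\<close>, then some component of \<open>y\<close> would keep its
  sign and have absolute value at least \<open>c / 2\<close> on a time interval of length \<open>T\<close>. Over this
  interval the component of \<open>z\<close> with the same index would move by at least \<open>c * T / 2\<close>, but the maximum
  principle for \<open>z\<close> allows a displacement of at most \<open>2 * M\<close>.
\<close>

lemma consensus_flow_range_infnorm_small:
  fixes S :: "real^'n^'n"
  assumes S: "row_stochastic S" and y: "consensus_flow (mat 1 - S) y"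
    and "y 0 = (mat 1 - S) *v z0" and "0 < c"
  shows "\<exists>t\<ge>0. infnorm (y t) < c"
proof (rule ccontr)
  assume "\<not> ?thesis"
  then have low: "c \<le> infnorm (y t)" if "0 \<le> t" for t
    using that by force
  obtain z where z: "consensus_flow (mat 1 - S) z" and Lz: "\<And>t. 0 \<le> t \<Longrightarrow> (mat 1 - S) *v z t = y t"
    using consensus_flow_lift[OF y assms(3)] by blast
  define l where "l = (INF t\<in>{0..}. infnorm (y t))"
  have bdd: "bdd_below ((\<lambda>t. infnorm (y t)) ` {0..})"
    using low by (intro bdd_belowI[where m = c]) auto
  have ll: "l \<le> infnorm (y t)" if "0 \<le> t" for t
    unfolding l_def using that by (intro cINF_lower[OF bdd]) auto
  define M where "M = infnorm (z 0)"
  \<comment> \<open>Long enough that \<open>c / 2 * T > 2 * M\<close>.\<close>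
  define T where "T = 4 * M / c + 1"
  have "0 \<le> M"
    by (simp add: M_def infnorm_pos_le)
  then have "0 < T"
    using \<open>0 < c\<close> by (simp add: T_def add_nonneg_pos)
  \<comment> \<open>The norm at \<open>s\<close> is so close to its infimum \<open>l\<close> that a gap at
    \<open>s + T\<close>, even when magnified by the factor \<open>exp T\<close> of the
    backward estimate, is at most \<open>c / 2\<close>.\<close>
  have "l < l + exp (- T) * (c / 2)"
    using \<open>0 < c\<close> by simp
  then obtain s where s: "0 \<le> s" "infnorm (y s) < l + exp (- T) * (c / 2)"
    unfolding l_def by (subst (asm) cINF_less_iff[OF _ bdd]) auto
  define t where "t = s + T"
  define K where "K = infnorm (y s)"
  have t: "s \<le> t" "0 \<le> t"
    using s \<open>0 < T\<close> by (auto simp: t_def)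
  obtain i where i: "\<bar>y t $ i\<bar> = infnorm (y t)"
    by (rule infnorm_attained_cart)
  define \<sigma> :: real where "\<sigma> = (if y t $ i \<ge> 0 then 1 else - 1)"
  have \<sigma>: "\<bar>\<sigma>\<bar> = 1" "\<sigma> * y t $ i = infnorm (y t)"
    using i by (auto simp: \<sigma>_def)
  have half: "c / 2 \<le> \<sigma> * y r $ i" if r: "s \<le> r" "r \<le> t" for r
  proof -
    have "K - \<sigma> * y r $ i \<le> exp (t - r) * (K - \<sigma> * y t $ i)"
      by (rule consensus_gap_backward_estimate[OF S y])
        (use r s \<sigma> consensus_flow_infnorm_antimono[OF S y] in \<open>auto simp: K_def\<close>)
    also have "\<dots> \<le> exp T * (exp (- T) * (c / 2))"
    proof (rule mult_mono)
      show "exp (t - r) \<le> exp T"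
        using r by (simp add: t_def)
      show "K - \<sigma> * y t $ i \<le> exp (- T) * (c / 2)"
        using s(2) ll[OF \<open>0 \<le> t\<close>] \<sigma>(2) by (simp add: K_def)
      show "0 \<le> K - \<sigma> * y t $ i"
        using consensus_flow_infnorm_antimono[OF S y s(1) t(1)] \<sigma>(2) by (simp add: K_def)
    qed auto
    also have "\<dots> = c / 2"
      by (simp add: exp_minus field_simps)
    finally show ?thesis
      using low[OF s(1)] by (simp add: K_def)
  qed
  have "- (\<sigma> * z s $ i) - c / 2 * s \<le> - (\<sigma> * z t $ i) - c / 2 * t"
  proof (rule DERIV_nonneg_imp_increasing_open[OF t(1)])
    fix r assume r: "s < r" "r < t"
    then have "((\<lambda>r. z r $ i) has_real_derivative - (y r $ i)) (at r)"
      using consensus_flow_component_deriv[OF z, of r i] Lz[of r] s(1) by simp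
    then have "((\<lambda>r. - (\<sigma> * z r $ i) - c / 2 * r) has_real_derivative \<sigma> * y r $ i - c / 2) (at r)"
      by (auto intro!: derivative_eq_intros)
    then show "\<exists>D. ((\<lambda>r. - (\<sigma> * z r $ i) - c / 2 * r) has_real_derivative D) (at r) \<and> D \<ge> 0"
      using half[of r] r by (intro exI conjI) auto
  next
    show "continuous_on {s..t} (\<lambda>r. - (\<sigma> * z r $ i) - c / 2 * r)"
      using consensus_flow_continuous_on[OF z s(1)] by (intro continuous_intros) auto
  qed
  moreover have "\<bar>\<sigma> * z r $ i\<bar> \<le> M" if "0 \<le> r" for r
    using component_le_infnorm_cart[of "z r" i] consensus_flow_infnorm_antimono[OF S z order_refl that] \<sigma>(1)
    by (simp add: abs_mult M_def)
  from this[OF s(1)] this[OF t(2)] have "\<sigma> * z s $ i - \<sigma> * z t $ i \<le> 2 * M"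
    by linarith
  ultimately have "c / 2 * T \<le> 2 * M"
    by (simp add: t_def right_diff_distrib distrib_left)
  moreover have "c / 2 * T = 2 * M + c / 2"
    using \<open>0 < c\<close> by (simp add: T_def field_simps)
  ultimately show False
    using \<open>0 < c\<close> by simp
qed

lemma consensus_flow_range_tendsto_0:
  fixes S :: "real^'n^'n"
  assumes S: "row_stochastic S" and y: "consensus_flow (mat 1 - S) y"
    and y0: "y 0 \<in> range ((*v) (mat 1 - S))"
  shows "(y \<longlongrightarrow> 0) at_top"
proof (rule vec_tendstoI)
  fix i
  obtain z0 where z0: "y 0 = (mat 1 - S) *v z0"
    using y0 by auto
  show "((\<lambda>t. y t $ i) \<longlongrightarrow> 0 $ i) at_top"
  proof (rule tendstoI)
    fix e :: real assume "0 < e"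
    then obtain s where s: "0 \<le> s" "infnorm (y s) < e"
      using consensus_flow_range_infnorm_small[OF S y z0] by blast
    have "\<bar>y t $ i\<bar> < e" if "s \<le> t" for t
      using component_le_infnorm_cart[of "y t" i]
        consensus_flow_infnorm_antimono[OF S y s(1) that] s(2) by linarith
    then show "\<forall>\<^sub>F t in at_top. dist (y t $ i) (0 $ i) < e"
      by (auto simp: eventually_at_top_linorder)
  qed
qed

section \<open>The projection onto the kernel\<close>

text \<open>
  The left kernel of \<open>L\<close> is the orthogonal complement of the range of \<open>L\<close>, and in finite dimension
  the range is its own double complement.
\<close>

lemma orthogonal_to_left_kernel_imp_in_range:
  fixes L :: "real^'n^'n"
  assumes "\<And>p. p v* L = 0 \<Longrightarrow> p \<bullet> u = 0"
  shows "u \<in> range ((*v) L)"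
proof -
  have "subspace (range ((*v) L))"
    using matrix_vector_mul_linear[of L] subspace_UNIV by (rule linear_subspace_image)
  then have eq: "orthogonal_comp (orthogonal_comp (range ((*v) L))) = range ((*v) L)"
    by (rule orthogonal_comp_self)
  have "p v* L = 0" if "p \<in> orthogonal_comp (range ((*v) L))" for p
  proof -
    have "(p v* L) \<bullet> (p v* L) = p \<bullet> (L *v (p v* L))"
      by (simp add: dot_lmul_matrix)
    also have "\<dots> = 0"
      using that by (auto simp: orthogonal_comp_def orthogonal_def inner_commute)
    finally show ?thesis
      by simp
  qed
  then have "u \<in> orthogonal_comp (orthogonal_comp (range ((*v) L)))"
    using assms by (auto simp: orthogonal_comp_def[of "orthogonal_comp _"] orthogonal_def)
  then show ?thesis
    by (simp add: eq)
qed

text \<open>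
  The reach of a root of \<open>X\<close> that lies in \<open>Y\<close> is contained in \<open>Y\<close>, so that \<open>X \<subseteq> Y\<close>, against the
  maximality of \<open>X\<close>.
\<close>

lemma cabal_disjoint_other_reach:
  assumes "X \<in> reaches E" "Y \<in> reaches E" "X \<noteq> Y"
  shows "cabal E X \<inter> Y = {}"
proof (rule ccontr)
  assume "cabal E X \<inter> Y \<noteq> {}"
  then obtain r where r: "reachable_set E r = X" "r \<in> Y"
    by (auto simp: cabal_def)
  obtain s where s: "Y = reachable_set E s"
    using assms(2) by (auto simp: reaches_def)
  have "reachable_set E r \<subseteq> reachable_set E s"
    using r(2) unfolding s reachable_set_def by (auto intro: trancl_trans)
  then have "X \<subseteq> Y"
    using r(1) s by simp
  moreover have "Y \<in> range (reachable_set E)"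
    using s by blast
  ultimately have "Y = X"
    using assms(1) unfolding reaches_def by blast
  with assms(3) show False
    by simp
qed

text \<open>
  A cabal lies in the exclusive part of its own reach and outside all others. On the support of
  the \<open>l\<close>-th left vector the \<open>m\<close>-th right vector is therefore constant, equal to 1 or 0, and the
  entries of the left vector add up to 1.
\<close>

lemma reach_bases_biorthogonal:
  assumes R: "bij_betw R {1..k} (reaches E)"
    and right: "reach_basis_right E w k R \<gamma>"
    and left: "reach_basis_left E w k R \<gamma>'"
    and l: "l \<in> {1..k}" and m: "m \<in> {1..k}"
  shows "\<gamma>' l \<bullet> \<gamma> m = (if l = m then 1 else 0)"
proof -
  have Rl: "R l \<in> reaches E" and Rm: "R m \<in> reaches E"
    using R l m by (auto dest: bij_betwE)
  have val: "\<gamma> m $ v = (if l = m then 1 else 0)" if v: "v \<in> cabal E (R l)" for v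
  proof (cases "l = m")
    case True
    have "v \<in> exclusive_part E (R m)"
      using v cabal_disjoint_other_reach[OF Rl] True
      by (auto simp: exclusive_part_def cabal_def)
    then show ?thesis
      using right m True by (auto simp: reach_basis_right_def)
  next
    case False
    then have "R l \<noteq> R m"
      using inj_on_eq_iff[OF bij_betw_imp_inj_on[OF R] l m] by simp
    then have "v \<notin> R m"
      using v cabal_disjoint_other_reach[OF Rl Rm] by auto
    then show ?thesis
      using right m False by (auto simp: reach_basis_right_def)
  qed
  have set: "{v. \<gamma>' l $ v \<noteq> 0} = cabal E (R l)" and sum: "(\<Sum>v\<in>UNIV. \<gamma>' l $ v) = 1"
    using left l unfolding reach_basis_left_def by blast+
  have "\<gamma>' l $ v * \<gamma> m $ v = \<gamma>' l $ v * (if l = m then 1 else 0)" for v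
  proof (cases "v \<in> cabal E (R l)")
    case True
    then show ?thesis by (simp only: val)
  next
    case False
    then have "\<gamma>' l $ v = 0"
      unfolding set[symmetric] by simp
    then show ?thesis by simp
  qed
  then have "\<gamma>' l \<bullet> \<gamma> m = (\<Sum>v\<in>UNIV. \<gamma>' l $ v) * (if l = m then 1 else 0)"
    unfolding inner_vec_def inner_real_def sum_distrib_right by (intro sum.cong refl)
  then show ?thesis
    unfolding sum by simp
qed

theorem theorem5p4:
  fixes E :: "('n::finite \<times> 'n) set"
    and w :: "'n \<Rightarrow> 'n \<Rightarrow> real"
    and k :: nat
    and R :: "nat \<Rightarrow> 'n set"
    and \<gamma> \<gamma>' :: "nat \<Rightarrow> real^'n"
    and x0 :: "real^'n"
    and x :: "real \<Rightarrow> real^'n"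
  assumes "weighted_digraph E w"
    and "bij_betw R {1..k} (reaches E)"
    and "reach_basis_right E w k R \<gamma>"
    and "reach_basis_left E w k R \<gamma>'"
    and "consensus_solution (rw_laplacian E w) x0 x"
  shows "(x \<longlongrightarrow> (\<Sum>m=1..k. (\<gamma>' m \<bullet> x0) *\<^sub>R \<gamma> m)) at_top"
proof -
  let ?S = "transition_matrix E w"
  define L where "L = mat 1 - ?S"
  have L: "rw_laplacian E w = L"
    by (simp add: L_def rw_laplacian_def)
  define p where "p = (\<Sum>m=1..k. (\<gamma>' m \<bullet> x0) *\<^sub>R \<gamma> m)"
  define y where "y t = x t - p" for t
  have "\<gamma> m \<in> {x. L *v x = 0}" if "m \<in> {1..k}" for m
    using assms(3) that span_superset[of "\<gamma> ` {1..k}"]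
    unfolding reach_basis_right_def is_basis_of_def L by blast
  then have Lp: "L *v p = 0"
    by (simp add: p_def vec.sum matrix_vector_mult_scaleR)
  have y: "consensus_flow L y"
    using assms(5) Lp unfolding consensus_solution_def consensus_flow_def y_def L
    by (auto simp: matrix_vector_mult_diff_distrib intro!: derivative_eq_intros)
  have "y 0 \<in> range ((*v) L)"
  proof (rule orthogonal_to_left_kernel_imp_in_range)
    fix q assume "q v* L = 0"
    then have q: "q \<in> span (\<gamma>' ` {1..k})"
      using assms(4) unfolding reach_basis_left_def is_basis_of_def L by blast
    have "y 0 \<bullet> \<gamma>' l = 0" if l: "l \<in> {1..k}" for l
    proof -
      have "\<gamma>' l \<bullet> p = (\<Sum>m=1..k. (\<gamma>' m \<bullet> x0) * (\<gamma>' l \<bullet> \<gamma> m))"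
        by (simp add: p_def inner_sum_right)
      also have "\<dots> = (\<Sum>m=1..k. if l = m then \<gamma>' m \<bullet> x0 else 0)"
        by (intro sum.cong refl)
          (simp add: reach_bases_biorthogonal[OF assms(2-4) l])
      also have "\<dots> = \<gamma>' l \<bullet> x0"
        using l by simp
      finally show ?thesis
        using assms(5)
        by (simp add: y_def consensus_solution_def inner_diff_right inner_commute[of "x0 - p"])
    qed
    then have "orthogonal (y 0) q"
      by (intro orthogonal_to_span[OF q]) (auto simp: orthogonal_def)
    then show "q \<bullet> y 0 = 0"
      by (simp add: orthogonal_def inner_commute)
  qed
  then have "(y \<longlongrightarrow> 0) at_top"
    using consensus_flow_range_tendsto_0[OF row_stochastic_transition_matrix[OF assms(1)]] y
    unfolding L_def by blast
  then show ?thesis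
    unfolding y_def p_def by (simp add: LIM_zero_iff)
qed

end
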